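(* The ordered set $L_B(\infty)$ is a lattice. Moreover, if $a=(\infty,a_2,\dots,a_k)$ and $b=(\infty,b_2,\dots,b_l)$ are two elements of $L_B(\infty)$, then $\inf_{L_B(\infty)}(a,b)=c$, where $c=(\infty,c_2,c_3,\dots)$ is defined by $$c_i=\max\Big(\sum_{j\ge i}a_j,\ \sum_{j\ge i}b_j\Big)-\sum_{j>i}c_j\qquad\text{for all } i \text{ such that } 2\le i\le \max(k,l),$$ with $c_i=0$ for $i>\max(k,l)$.
   Context: Configurations are sequences $a=(a_1,a_2,\dots,a_k)$, non-increasing, with $a_1=\infty$ and $a_2,\dots,a_k$ positive integers; by convention $a_j=0$ for $j>k$. Let $d_i(a)=a_i-a_{i+1}$ (so $d_1(a)=\infty$). There are two evolution rules (transitions): (1) if $d_i(a)\ge 2$ (a cliff at $i$), one grain may fall from column $i$ to column $i+1$, i.e. $a_i$ is decreased by $1$ and $a_{i+1}$ increased by $1$ (with $\infty-1=\infty$); (2) if $a$ has a slippery step of length $m\ge 1$ at $i$, i.e. $a_i-1=a_{i+1}=\dots=a_{i+m}$ and $a_{i+m}-a_{i+m+1}=1$ (with $i\ge 2$), one grain may slip from column $i$ to column $i+m+1$, i.e. $a_i$ is decreased by $1$ and $a_{i+m+1}$ is increased by $1$. $L_B(\infty)$ is the set of all configurations reachable from $(\infty)$ by finitely many transitions, ordered by: $a\ge b$ iff $b$ can be reached from $a$ by a finite (possibly empty) sequence of transitions. Equivalently, for $a$ of length $p$ and $b$ of length $q$: $a\ge b$ iff $\sum_{i\ge j}a_i\le\sum_{i\ge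 j}b_i$ for all $j$ with $2\le j\le\max(p,q)$. *)

theory Defs
  imports "HOL-Library.Extended_Nat" "HOL-Algebra.Lattice"
begin

text \<open>
  A sequence \<open>(a\<^sub>1, \<dots>, a\<^sub>k)\<close> is encoded as the function \<open>a\<close> sending \<open>i\<close> to \<open>a\<^sub>i\<close> for
  \<open>1 \<le> i \<le> k\<close> and to \<open>0\<close> for \<open>i > k\<close>. Columns are numbered from \<open>1\<close>; the unused index \<open>0\<close> carries
  the dummy value \<open>0\<close>, so that every sequence has exactly one encoding. Subtraction on \<^typ>\<open>enat\<close>
  satisfies \<open>\<infinity> - n = \<infinity>\<close> for finite \<open>n\<close> and is truncated at \<open>0\<close>.
\<close>

type_synonym config = "nat \<Rightarrow> enat"

definition configuration :: "config \<Rightarrow> bool" where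
  "configuration a \<longleftrightarrow>
     a 0 = 0 \<and> a 1 = \<infinity> \<and> (\<forall>i\<ge>2. a i \<noteq> \<infinity>) \<and> (\<forall>i\<ge>1. a (i + 1) \<le> a i) \<and> finite {i. a i \<noteq> 0}"

definition len :: "config \<Rightarrow> nat" where
  "len a = Max {i. a i \<noteq> 0}"

definition infinite_column :: config where
  "infinite_column = (\<lambda>i. if i = 1 then \<infinity> else 0)"

definition height_diff :: "config \<Rightarrow> nat \<Rightarrow> enat" where
  "height_diff a i = a i - a (i + 1)"

definition slippery_step :: "config \<Rightarrow> nat \<Rightarrow> nat \<Rightarrow> bool" where
  "slippery_step a m i \<longleftrightarrow>
     1 \<le> m \<and> 2 \<le> i \<and> (\<forall>j\<in>{i + 1..i + m}. a i - 1 = a j) \<and> a (i + m) - a (i + m + 1) = 1"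

definition move_grain :: "config \<Rightarrow> nat \<Rightarrow> nat \<Rightarrow> config" where
  "move_grain a i j = a(i := a i - 1, j := a j + 1)"

inductive transition :: "config \<Rightarrow> config \<Rightarrow> bool" where
  fall: "1 \<le> i \<Longrightarrow> height_diff a i \<ge> 2 \<Longrightarrow> transition a (move_grain a i (i + 1))"
| slip: "slippery_step a m i \<Longrightarrow> transition a (move_grain a i (i + m + 1))"

definition LB_set :: "config set" where
  "LB_set = {a. configuration a \<and> transition\<^sup>*\<^sup>* infinite_column a}"

definition LB :: "config gorder" where
  "LB = \<lparr>carrier = LB_set, eq = (=), le = (\<lambda>b a. transition\<^sup>*\<^sup>* a b)\<rparr>"

definition tail_sum :: "config \<Rightarrow> nat \<Rightarrow> enat" where
  "tail_sum a i = (\<Sum>j = i..len a. a j)"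

text \<open>
  The columns are computed downwards from index \<open>max (len a) (len b)\<close>; as all later ones vanish,
  \<open>\<Sum>\<^bsub>j > i\<^esub> c\<^sub>j\<close> stops at that index.
\<close>

function inf_config :: "config \<Rightarrow> config \<Rightarrow> config" where
  "inf_config a b i =
     (if i = 0 then 0
      else if i = 1 then \<infinity>
      else if i \<le> max (len a) (len b) then
        max (tail_sum a i) (tail_sum b i)
          - (\<Sum>j = i + 1..max (len a) (len b). inf_config a b j)
      else 0)"
  by pat_completeness auto
termination
  by (relation "measure (\<lambda>(a, b, i). Suc (max (len a) (len b)) - i)") auto

declare inf_config.simps [simp del]

lemma configuration_infinite_column: "configuration infinite_column"
proof -
  have "{i. infinite_column i \<noteq> 0} = {1}"
    by (auto simp: infinite_column_def)
  then show ?thesis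
    by (auto simp: configuration_def infinite_column_def)
qed

lemma configuration_move_grain:
  assumes a: "configuration a" and i: "1 \<le> i" "i < j"
    and top: "a (i + 1) + (if j = i + 1 then 2 else 1) \<le> a i"
    and bot: "j > i + 1 \<Longrightarrow> a j + 1 \<le> a (j - 1)"
  shows "configuration (move_grain a i j)"
proof -
  have fin: "a n \<noteq> \<infinity>" if "n \<ge> 2" for n
    using a that by (simp add: configuration_def)
  have mono: "a (n + 1) \<le> a n" if "n \<ge> 1" for n
    using a that by (simp add: configuration_def)
  have "move_grain a i j (n + 1) \<le> move_grain a i j n" if n: "n \<ge> 1" for n
  proof -
    obtain x where x: "a (n + 1) = enat x"
      using fin[of "n + 1"] n by auto
    show ?thesis
      using mono[OF n] top bot i n x
      by (cases "a n") (auto simp: move_grain_def one_enat_def numeral_eq_enat split: if_splits)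
  qed
  moreover have "finite {n. move_grain a i j n \<noteq> 0}"
    by (rule finite_subset[of _ "{n. a n \<noteq> 0} \<union> {j}"])
      (use a in \<open>auto simp: configuration_def move_grain_def split: if_splits\<close>)
  moreover have "move_grain a i j 0 = 0" "move_grain a i j 1 = \<infinity>"
    using a i by (auto simp: configuration_def move_grain_def one_enat_def)
  moreover have "move_grain a i j n \<noteq> \<infinity>" if "n \<ge> 2" for n
    using fin[OF that] by (cases "a n") (auto simp: move_grain_def one_enat_def)
  ultimately show ?thesis
    by (simp add: configuration_def)
qed

text \<open>The rules preserve configurations, so every intermediate state is one.\<close>

lemma configuration_transition:
  assumes "transition a b" "configuration a"
  shows "configuration b"
  using assms
proof cases
  case (fall i)
  have "a (i + 1) \<noteq> \<infinity>"
    using assms(2) fall by (auto simp: configuration_def)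
  then have "a (i + 1) + 2 \<le> a i"
    using fall by (cases "a i"; cases "a (i + 1)")
      (auto simp: height_diff_def numeral_eq_enat)
  then show ?thesis
    using fall assms(2) by (auto intro!: configuration_move_grain)
next
  case (slip m i)
  then have s: "1 \<le> m" "2 \<le> i" "a i - 1 = a (i + 1)" "a i - 1 = a (i + m)"
      "a (i + m) - a (i + m + 1) = 1"
    by (auto simp: slippery_step_def)
  have f: "a i \<noteq> \<infinity>" "a (i + 1) \<noteq> \<infinity>" "a (i + m) \<noteq> \<infinity>" "a (i + m + 1) \<noteq> \<infinity>"
    using assms(2) s by (auto simp: configuration_def)
  then obtain p q r t where
    e: "a i = enat p" "a (i + 1) = enat q" "a (i + m) = enat r" "a (i + m + 1) = enat t"
    by (meson not_infinity_eq)
  have "a (i + 1) + 1 \<le> a i" "a (i + m + 1) + 1 \<le> a (i + m)"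
    using s(3-5) unfolding e by (auto simp: one_enat_def)
  then show ?thesis
    unfolding slip(1) using s(1,2) assms(2)
    by (intro configuration_move_grain) auto
qed

end

theory Submission
  imports Defs
begin

text \<open>
  A configuration is determined by its tail sums \<open>A\<^sub>j = \<Sum>\<^bsub>i \<ge> j\<^esub> a\<^sub>i\<close> for \<open>j \<ge> 2\<close>, and a move from
  column \<open>i\<close> to column \<open>k\<close> raises exactly \<open>A\<^bsub>i+1\<^esub>, \<dots>, A\<^sub>k\<close> by one. Conversely, if \<open>A \<le> B\<close>
  pointwise and \<open>A \<noteq> B\<close>, take a maximal interval \<open>q + 1, \<dots>, e\<close> of indices on which \<open>A < B\<close>. Then
  \<open>a\<^sub>q > b\<^sub>q \<ge> b\<^sub>e > a\<^sub>e\<close> (or \<open>q = 1\<close>), so \<open>a\<close> drops by at least two between \<open>q\<close> and \<open>e\<close>, and some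
  transition inside this interval keeps \<open>A \<le> B\<close>. Hence reachability is the pointwise order of
  tail sums, and every configuration is reachable from \<open>(\<infinity>)\<close>. Tail sums are exactly the
  eventually zero, decreasing, convex sequences, which are closed under pointwise maximum; this
  gives the meets. A join of \<open>a\<close> and \<open>b\<close> is an upper bound with the largest total of tail sums: its
  meet with any other upper bound is again an upper bound, with at least the same total.
\<close>

section \<open>Tail sums as coordinates of a configuration\<close>

text \<open>Natural-number counterpart of \<open>tail_sum\<close>, meaningful from index 2 on, where
  all columns are finite.\<close>

definition tail :: "config \<Rightarrow> nat \<Rightarrow> nat" where
  "tail a j = (\<Sum>i = j..len a. the_enat (a i))"

lemma configuration_finite:
  assumes "configuration a" "2 \<le> i"
  shows "a i = enat (the_enat (a i))"
proof -
  have "a i \<noteq> \<infinity>"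
    using assms unfolding configuration_def by blast
  then show ?thesis by auto
qed

lemma configuration_antimono:
  assumes "configuration a" "1 \<le> i" "i \<le> j"
  shows "a j \<le> a i"
  using assms(3,2)
proof (induction j rule: dec_induct)
  case (step n)
  then have "a (Suc n) \<le> a n"
    using assms(1) by (auto simp: configuration_def)
  then show ?case
    using step by auto
qed simp

lemma configuration_beyond_len:
  assumes "configuration a" "len a < i"
  shows "a i = 0"
proof (rule ccontr)
  assume "a i \<noteq> 0"
  then have "i \<le> len a"
    unfolding len_def using assms(1) by (intro Max_ge) (auto simp: configuration_def)
  with assms(2) show False by simp
qed

lemma tail_beyond_len: "len a < j \<Longrightarrow> tail a j = 0"
  by (simp add: tail_def)

lemma tail_rec:
  assumes "configuration a"
  shows "tail a j = the_enat (a j) + tail a (Suc j)"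
proof (cases "j \<le> len a")
  case True
  then show ?thesis by (simp add: tail_def sum.atLeast_Suc_atMost)
next
  case False
  then show ?thesis
    using configuration_beyond_len[OF assms, of j] by (simp add: tail_def zero_enat_def)
qed

lemma tail_sum_eq_tail:
  assumes "configuration a" "2 \<le> i"
  shows "tail_sum a i = enat (tail a i)"
proof -
  have "tail_sum a i = (\<Sum>j = i..len a. enat (the_enat (a j)))"
    unfolding tail_sum_def using assms by (intro sum.cong) (auto intro: configuration_finite)
  also have "\<dots> = enat (tail a i)"
    unfolding tail_def by (induction rule: infinite_finite_induct) (auto simp: zero_enat_def)
  finally show ?thesis .
qed

text \<open>Downward induction from an index where both sides vanish. This computes the tails of a
  new configuration without determining its \<open>len\<close>.\<close>

lemma tail_unique:
  assumes a: "configuration a"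
    and rec: "\<And>j. 2 \<le> j \<Longrightarrow> F j = the_enat (a j) + F (Suc j)"
    and zero: "\<And>j. N < j \<Longrightarrow> F j = 0"
    and j: "2 \<le> j"
  shows "tail a j = F j"
proof -
  define M where "M = Suc (max (max N (len a)) j)"
  have "j \<le> M" by (simp add: M_def)
  then show ?thesis
    using j
  proof (induction j rule: inc_induct)
    case base
    then show ?case by (simp add: zero tail_beyond_len M_def)
  next
    case (step n)
    then show ?case using rec[of n] tail_rec[OF a, of n] by simp
  qed
qed

lemma configuration_eqI:
  assumes a: "configuration a" and b: "configuration b"
    and eq: "\<And>j. 2 \<le> j \<Longrightarrow> tail a j = tail b j"
  shows "a = b"
proof
  fix i :: nat
  consider "i = 0" | "i = 1" | "2 \<le> i" by linarith
  then show "a i = b i"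
  proof cases
    case 3
    then have "the_enat (a i) = the_enat (b i)"
      using tail_rec[OF a, of i] tail_rec[OF b, of i] eq[of i] eq[of "Suc i"] by simp
    then show ?thesis
      using configuration_finite[OF a 3] configuration_finite[OF b 3] by simp
  qed (use a b in \<open>simp_all add: configuration_def\<close>)
qed

section \<open>Effect of transitions on tail sums\<close>

lemma tail_move_grain:
  assumes a: "configuration a" and c: "configuration (move_grain a i k)"
    and i: "1 \<le> i" "i < k" and pos: "a i \<noteq> 0" and j: "2 \<le> j"
  shows "tail (move_grain a i k) j = tail a j + (if i < j \<and> j \<le> k then 1 else 0)"
proof (rule tail_unique[OF c, where N = "max (len a) k"])
  fix n :: nat assume n: "2 \<le> n"
  \<comment> \<open>As \<open>2 \<le> n\<close>, the guard excludes column 1, where removing a grain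
    changes nothing.\<close>
  have "the_enat (a i - 1) + 1 = the_enat (a i)" if "i = n"
    using configuration_finite[OF a n] pos that
    by (cases "a i") (auto simp: one_enat_def zero_enat_def)
  moreover have "the_enat (a k + 1) = the_enat (a k) + 1"
    using configuration_finite[OF a, of k] i by (cases "a k") (auto simp: one_enat_def)
  ultimately show "tail a n + (if i < n \<and> n \<le> k then 1 else 0)
      = the_enat (move_grain a i k n) + (tail a (Suc n) + (if i < Suc n \<and> Suc n \<le> k then 1 else 0))"
    using tail_rec[OF a, of n] i by (auto simp: move_grain_def)
next
  fix n assume "max (len a) k < n"
  then show "tail a n + (if i < n \<and> n \<le> k then 1 else 0) = 0"
    by (simp add: tail_beyond_len)
qed (use j in simp)

lemma transition_tail_le:
  assumes t: "transition a b" and a: "configuration a" and j: "2 \<le> j"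
  shows "tail a j \<le> tail b j"
proof -
  have b: "configuration b" using configuration_transition[OF t a] .
  from t show ?thesis
  proof cases
    case (fall i)
    then have "a i \<noteq> 0" by (auto simp: height_diff_def)
    then show ?thesis
      using tail_move_grain[OF a, of i "i + 1" j] b fall j by simp
  next
    case (slip m i)
    have "a (i + m) \<noteq> 0"
      using slip by (auto simp: slippery_step_def)
    moreover have "a (i + m) \<le> a i"
      using slip by (intro configuration_antimono[OF a]) (auto simp: slippery_step_def)
    ultimately have "a i \<noteq> 0" by auto
    then show ?thesis
      using tail_move_grain[OF a, of i "i + m + 1" j] b slip j by (auto simp: slippery_step_def)
  qed
qed

lemma reachable_configuration:
  assumes "transition\<^sup>*\<^sup>* a b" "configuration a"
  shows "configuration b"
  using assms by (induction rule: rtranclp_induct) (auto intro: configuration_transition)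

lemma reachable_tail_le:
  assumes "transition\<^sup>*\<^sup>* a b" "configuration a" "2 \<le> j"
  shows "tail a j \<le> tail b j"
  using assms
proof (induction rule: rtranclp_induct)
  case (step y z)
  then show ?case
    using transition_tail_le[OF step(2) reachable_configuration[OF step(1,4)], of j] by simp
qed simp

section \<open>Reachability from comparison of tail sums\<close>

lemma last_index_satisfying:
  fixes q e :: nat
  assumes "P q" "q \<le> e"
  obtains i where "q \<le> i" "i \<le> e" "P i" "\<And>t. i < t \<Longrightarrow> t \<le> e \<Longrightarrow> \<not> P t"
proof -
  let ?i = "GREATEST t. t \<le> e \<and> P t"
  have "?i \<le> e \<and> P ?i"
    by (rule GreatestI_nat[of _ q e]) (use assms in auto)
  moreover have "t \<le> ?i" if "t \<le> e \<and> P t" for t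
    by (rule Greatest_le_nat[of _ _ e]) (use that in auto)
  ultimately show ?thesis
    using that assms by (metis leD)
qed

text \<open>Let \<open>i\<close> and \<open>k\<close> be the last columns up to \<open>e\<close> of
  height at least \<open>a e + 2\<close> and \<open>a e + 1\<close>. Columns \<open>i + 1\<close> to
  \<open>k\<close> then form a plateau of height \<open>a e + 1\<close>, followed by height
  \<open>a e\<close>. Either there is a cliff at \<open>i\<close>, or a grain slips from
  \<open>i\<close> across the plateau to \<open>k + 1\<close>.\<close>

lemma transition_in_interval:
  assumes a: "configuration a" and q: "1 \<le> q" "q \<le> e" and drop: "a e + 2 \<le> a q"
    and fin: "a e \<noteq> \<infinity>"
  obtains i k where "q \<le> i" "i < k" "k \<le> e" "a i \<noteq> 0" "transition a (move_grain a i k)"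
proof -
  obtain i where i: "q \<le> i" "i \<le> e" "a e + 2 \<le> a i"
    and i_last: "\<And>t. i < t \<Longrightarrow> t \<le> e \<Longrightarrow> \<not> a e + 2 \<le> a t"
    using last_index_satisfying[of "\<lambda>t. a e + 2 \<le> a t" q e] drop q by metis
  have "a e + 1 \<le> a i" using i fin by (cases "a e"; cases "a i") (auto simp: one_enat_def numeral_eq_enat)
  then obtain k where k: "i \<le> k" "k \<le> e" "a e + 1 \<le> a k"
    and k_last: "\<And>t. k < t \<Longrightarrow> t \<le> e \<Longrightarrow> \<not> a e + 1 \<le> a t"
    using last_index_satisfying[of "\<lambda>t. a e + 1 \<le> a t" i e] i by metis
  obtain x where x: "a e = enat x" using fin by auto
  have "k \<noteq> e" using k x by (auto simp: one_enat_def)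
  then have ke: "k < e" using k by simp
  have pos: "a i \<noteq> 0" using i x by (auto simp: numeral_eq_enat zero_enat_def)
  have after: "a (k + 1) = enat x"
    using k_last[of "k + 1"] ke q i k configuration_antimono[OF a, of "k + 1" e] x
    by (cases "a (k + 1)") (auto simp: one_enat_def)
  have between: "a t = enat (x + 1)" if t: "i < t" "t \<le> k" for t
    using i_last[of t] ke q i k configuration_antimono[OF a, of t k] x t
    by (cases "a t"; cases "a k") (auto simp: one_enat_def numeral_eq_enat)
  show ?thesis
  proof (cases "height_diff a i \<ge> 2")
    case True
    then show ?thesis
      using that[of i "i + 1"] transition.fall[of i a] q i k ke pos by auto
  next
    case False
    \<comment> \<open>With an empty plateau, column \<open>i + 1\<close> would have height
      \<open>a e\<close>, making a cliff at \<open>i\<close>.\<close>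
    have ik: "i < k"
    proof (rule ccontr)
      assume "\<not> i < k"
      then have "height_diff a i \<ge> 2"
        using after i k x by (cases "a i") (auto simp: height_diff_def numeral_eq_enat)
      with False show False by simp
    qed
    then have "a (i + 1) = enat (x + 1)" using between[of "i + 1"] by simp
    then have ai: "a i = enat (x + 2)"
      using False i x by (cases "a i") (auto simp: height_diff_def numeral_eq_enat)
    have "i \<noteq> 1" using ai a by (auto simp: configuration_def)
    then have "slippery_step a (k - i) i"
      using ik ai q i after between k
      by (auto simp: slippery_step_def one_enat_def)
    from transition.slip[OF this] show ?thesis
      using that[of i "k + 1"] ik i ke pos by simp
  qed
qed

text \<open>The index \<open>p\<close> records strict progress, which drives the induction for
  reachability.\<close>

lemma transition_below:
  assumes a: "configuration a" and b: "configuration b"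
    and le: "\<And>j. 2 \<le> j \<Longrightarrow> tail a j \<le> tail b j" and ne: "a \<noteq> b"
  obtains c p where "transition a c" "\<And>j. 2 \<le> j \<Longrightarrow> tail c j \<le> tail b j"
    "2 \<le> p" "tail a p < tail c p"
proof -
  obtain j where j: "2 \<le> j" "tail a j < tail b j"
    using configuration_eqI[OF a b] ne le le_neq_implies_less by metis
  have jb: "j \<le> len b" using j tail_beyond_len[of b j] by (cases "j \<le> len b") auto
  obtain e where e: "j \<le> e" "tail a e < tail b e"
    and e_last: "\<And>t. e < t \<Longrightarrow> t \<le> len b \<Longrightarrow> \<not> tail a t < tail b t"
    by (rule last_index_satisfying[of "\<lambda>t. tail a t < tail b t" j "len b"]) (use j jb in auto)
  have "tail a (Suc e) = tail b (Suc e)"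
    using e_last[of "Suc e"] le[of "Suc e"] tail_beyond_len[of b "Suc e"] e j
    by (cases "Suc e \<le> len b") auto
  then have ae: "the_enat (a e) < the_enat (b e)"
    using e tail_rec[OF a, of e] tail_rec[OF b, of e] by simp
  \<comment> \<open>The alternative \<open>q = 1\<close> is a sentinel: tails are compared only from
    index 2, and the infinite column supplies the drop there.\<close>
  obtain q where q: "1 \<le> q" "q \<le> e" "q = 1 \<or> tail a q = tail b q"
    and q_last: "\<And>t. q < t \<Longrightarrow> t \<le> e \<Longrightarrow> \<not> (t = 1 \<or> tail a t = tail b t)"
    by (rule last_index_satisfying[of "\<lambda>t. t = 1 \<or> tail a t = tail b t" 1 e]) (use e j in auto)
  have qe: "q < e" using q e j by (cases "q = e") auto
  obtain x y where xy: "a e = enat x" "b e = enat y" "x < y"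
    using ae configuration_finite[OF a, of e] configuration_finite[OF b, of e] e j by auto
  have "a e + 2 \<le> a q"
  proof (cases "q = 1")
    case True
    then show ?thesis using a by (simp add: configuration_def)
  next
    case False
    then have "2 \<le> q" using q by simp
    moreover have "tail a (Suc q) < tail b (Suc q)"
      using q_last[of "Suc q"] le[of "Suc q"] qe q by simp
    ultimately have "the_enat (b q) < the_enat (a q)"
      using q False tail_rec[OF a, of q] tail_rec[OF b, of q] by simp
    then obtain u v where "a q = enat u" "b q = enat v" "v < u"
      using configuration_finite[OF a \<open>2 \<le> q\<close>] configuration_finite[OF b \<open>2 \<le> q\<close>] by auto
    then show ?thesis
      using configuration_antimono[OF b, of q e] q xy by (simp add: numeral_eq_enat)
  qed
  moreover have "a e \<noteq> \<infinity>" using xy by simp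
  ultimately obtain i k where ik: "q \<le> i" "i < k" "k \<le> e" "a i \<noteq> 0"
    and t: "transition a (move_grain a i k)"
    by (rule transition_in_interval[OF a q(1,2)])
  have mv: "tail (move_grain a i k) n = tail a n + (if i < n \<and> n \<le> k then 1 else 0)" if "2 \<le> n" for n
    using tail_move_grain[OF a configuration_transition[OF t a]] ik q that by simp
  show ?thesis
  proof (rule that[OF t])
    show "2 \<le> k" "tail a k < tail (move_grain a i k) k"
      using mv[of k] ik q by auto
    fix n :: nat assume n: "2 \<le> n"
    \<comment> \<open>Raised indices lie strictly after \<open>q\<close> and not after
      \<open>e\<close>, where the tail of \<open>a\<close> is strictly smaller, so there is room for
      one more.\<close>
    show "tail (move_grain a i k) n \<le> tail b n"
      using mv[OF n] le[OF n] q_last[of n] ik by (cases "i < n \<and> n \<le> k") auto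
  qed
qed

text \<open>Induction on the total deficit of tails. Summing up to \<open>len b\<close> suffices,
  since beyond it both tails are zero.\<close>

lemma reachable_if_tail_le:
  assumes b: "configuration b" and a: "configuration a"
    and le: "\<And>j. 2 \<le> j \<Longrightarrow> tail a j \<le> tail b j"
  shows "transition\<^sup>*\<^sup>* a b"
  using a le
proof (induction "\<Sum>j = 2..len b. tail b j - tail a j" arbitrary: a rule: less_induct)
  case less
  show ?case
  proof (cases "a = b")
    case False
    then obtain c p where t: "transition a c" and cb: "\<And>j. 2 \<le> j \<Longrightarrow> tail c j \<le> tail b j"
      and p: "2 \<le> p" "tail a p < tail c p"
      using transition_below[OF less(2) b less(3)] by metis
    have "p \<le> len b"
      using cb[of p] p tail_beyond_len[of b p] by (cases "p \<le> len b") auto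
    moreover have "tail b p - tail c p < tail b p - tail a p"
      using cb[of p] p by simp
    ultimately have "(\<Sum>j = 2..len b. tail b j - tail c j) < (\<Sum>j = 2..len b. tail b j - tail a j)"
      using p transition_tail_le[OF t less(2)]
      by (intro sum_strict_mono_ex1) (auto intro!: diff_le_mono2)
    then have "transition\<^sup>*\<^sup>* c b"
      using less(1)[of c] cb configuration_transition[OF t less(2)] by blast
    with t show ?thesis by (rule converse_rtranclp_into_rtranclp)
  qed simp
qed

lemma reachable_iff_tail_le:
  "configuration a \<Longrightarrow> configuration b \<Longrightarrow> transition\<^sup>*\<^sup>* a b \<longleftrightarrow> (\<forall>j\<ge>2. tail a j \<le> tail b j)"
  using reachable_if_tail_le reachable_tail_le by blast

lemma tail_infinite_column: "2 \<le> j \<Longrightarrow> tail infinite_column j = 0"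
  by (rule tail_unique[OF configuration_infinite_column, where F = "\<lambda>_. 0"])
    (auto simp: infinite_column_def zero_enat_def)

text \<open>The tails of \<open>infinite_column\<close> from index 2 on are zero, so they lie below
  those of every configuration.\<close>

lemma LB_set_eq: "LB_set = {a. configuration a}"
  by (auto simp: LB_set_def reachable_iff_tail_le configuration_infinite_column tail_infinite_column)

section \<open>Meets as pointwise maxima of tail sums\<close>

context
  fixes a b :: config
  assumes a: "configuration a" and b: "configuration b"
begin

lemma sum_inf_config:
  assumes "2 \<le> i"
  shows "(\<Sum>j = i..max (len a) (len b). inf_config a b j) = enat (max (tail a i) (tail b i))"
proof -
  define M where "M = Suc (max (max (len a) (len b)) i)"
  have "i \<le> M" by (simp add: M_def)
  then show ?thesis
    using assms
  proof (induction i rule: inc_induct)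
    case base
    then show ?case by (simp add: M_def tail_beyond_len zero_enat_def)
  next
    case (step n)
    \<comment> \<open>This keeps the subtraction in \<open>inf_config\<close> from being truncated,
      so the sum telescopes.\<close>
    have "max (tail a (Suc n)) (tail b (Suc n)) \<le> max (tail a n) (tail b n)"
      using tail_rec[OF a, of n] tail_rec[OF b, of n] by linarith
    then show ?case
      using step tail_sum_eq_tail[OF a, of n] tail_sum_eq_tail[OF b, of n]
      by (cases "n \<le> max (len a) (len b)")
        (simp_all add: sum.atLeast_Suc_atMost inf_config.simps[of a b n] tail_beyond_len zero_enat_def
          not_le)
  qed
qed

lemma inf_config_eq:
  assumes "2 \<le> i"
  shows "inf_config a b i
    = enat (max (tail a i) (tail b i) - max (tail a (Suc i)) (tail b (Suc i)))"
  using assms tail_sum_eq_tail[OF a, of i] tail_sum_eq_tail[OF b, of i] sum_inf_config[of "Suc i"]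
  by (simp add: inf_config.simps[of a b i] tail_beyond_len zero_enat_def max_def)

lemma configuration_inf_config: "configuration (inf_config a b)"
proof -
  have "inf_config a b (i + 1) \<le> inf_config a b i" if "1 \<le> i" for i
  proof (cases "i = 1")
    case True
    then show ?thesis by (simp add: inf_config.simps[of a b "Suc 0"])
  next
    case False
    then have i: "2 \<le> i" using that by simp
    \<comment> \<open>This is convexity of both tail sequences; their maximum inherits it, by using
      whichever tail attains the maximum at \<open>Suc i\<close>.\<close>
    have "the_enat (a (Suc i)) \<le> the_enat (a i)" "the_enat (b (Suc i)) \<le> the_enat (b i)"
      using configuration_antimono[OF a, of i "Suc i"] configuration_antimono[OF b, of i "Suc i"]
        configuration_finite[OF a] configuration_finite[OF b] i
      by (metis enat_ord_simps(1) le_SucI le_refl that)+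
    then show ?thesis
      using inf_config_eq[OF i] inf_config_eq[of "Suc i"] i
        tail_rec[OF a, of i] tail_rec[OF b, of i]
        tail_rec[OF a, of "Suc i"] tail_rec[OF b, of "Suc i"]
      by (auto simp: max_def)
  qed
  moreover have "inf_config a b i = 0" if "max 1 (max (len a) (len b)) < i" for i
  proof -
    have "i \<noteq> 0" "i \<noteq> 1" "\<not> i \<le> max (len a) (len b)"
      using that by linarith+
    then show ?thesis
      by (subst inf_config.simps) (simp only: if_False)
  qed
  then have "{i. inf_config a b i \<noteq> 0} \<subseteq> {..max 1 (max (len a) (len b))}"
    by (metis (mono_tags, lifting) atMost_iff leI mem_Collect_eq subsetI)
  then have "finite {i. inf_config a b i \<noteq> 0}"
    by (rule finite_subset) simp
  moreover have "inf_config a b 0 = 0" "inf_config a b 1 = \<infinity>"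
    by (simp_all add: inf_config.simps[of a b 0] inf_config.simps[of a b "Suc 0"])
  moreover have "inf_config a b i \<noteq> \<infinity>" if "2 \<le> i" for i
    using that by (simp add: inf_config_eq)
  ultimately show ?thesis
    unfolding configuration_def by blast
qed

lemma tail_inf_config:
  assumes "2 \<le> j"
  shows "tail (inf_config a b) j = max (tail a j) (tail b j)"
proof (rule tail_unique[OF configuration_inf_config, where N = "max (len a) (len b)"])
  fix n :: nat assume "2 \<le> n"
  then show "max (tail a n) (tail b n)
      = the_enat (inf_config a b n) + max (tail a (Suc n)) (tail b (Suc n))"
    using tail_rec[OF a, of n] tail_rec[OF b, of n] by (auto simp: inf_config_eq max_def)
qed (use assms in \<open>auto simp: tail_beyond_len\<close>)

end

section \<open>Existence of joins\<close>

text \<open>A minimum of convex sequences need not be convex, so the join is obtained by maximizing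
  a bounded total rather than by a formula.\<close>

lemma ex_greatest_tail_below:
  assumes a: "configuration a"
  obtains s where "configuration s" "\<And>j. 2 \<le> j \<Longrightarrow> tail s j \<le> min (tail a j) (tail b j)"
    "\<And>v j. configuration v \<Longrightarrow> (\<And>j. 2 \<le> j \<Longrightarrow> tail v j \<le> min (tail a j) (tail b j))
      \<Longrightarrow> 2 \<le> j \<Longrightarrow> tail v j \<le> tail s j"
proof -
  define U where "U u \<longleftrightarrow> configuration u \<and> (\<forall>j\<ge>2. tail u j \<le> min (tail a j) (tail b j))" for u
  define W where "W u = (\<Sum>j = 2..len a. tail u j)" for u
  have "U infinite_column"
    by (simp add: U_def configuration_infinite_column tail_infinite_column)
  moreover have "\<forall>u. U u \<longrightarrow> W u < Suc (W a)"
    by (auto simp: U_def W_def less_Suc_eq_le intro!: sum_mono)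
  ultimately have "\<exists>s. U s \<and> (\<forall>u. U u \<longrightarrow> W u \<le> W s)"
    by (rule ex_has_greatest_nat)
  then obtain s where s: "U s" and W_le: "\<And>u. U u \<Longrightarrow> W u \<le> W s"
    by blast
  show ?thesis
  proof (rule that[of s])
    fix v and j :: nat
    assume v: "configuration v" "\<And>j. 2 \<le> j \<Longrightarrow> tail v j \<le> min (tail a j) (tail b j)"
      and j: "2 \<le> j"
    have sc: "configuration s" using s by (simp add: U_def)
    let ?c = "inf_config s v"
    have c: "tail ?c n = max (tail s n) (tail v n)" if "2 \<le> n" for n
      using tail_inf_config[OF sc v(1) that] .
    have "U ?c"
      using s v configuration_inf_config[OF sc v(1)] by (auto simp: U_def c)
    show "tail v j \<le> tail s j"
    proof (rule ccontr)
      assume less: "\<not> tail v j \<le> tail s j"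
      \<comment> \<open>The total \<open>W\<close> counts indices only up to \<open>len a\<close>; a
        positive \<open>tail v j\<close> forces \<open>j\<close> into that range.\<close>
      then have "j \<le> len a"
        using v(2)[OF j] tail_beyond_len[of a j] by (cases "j \<le> len a") auto
      then have "W s < W ?c"
        unfolding W_def
        using j less by (intro sum_strict_mono_ex1) (auto simp: c intro!: bexI[of _ j])
      then show False using W_le[OF \<open>U ?c\<close>] by simp
    qed
  qed (use s in \<open>auto simp: U_def\<close>)
qed

section \<open>The lattice structure of \<open>LB\<close>\<close>

lemma carrier_LB: "carrier LB = {a. configuration a}"
  by (simp add: LB_def LB_set_eq)

text \<open>The order reverses tail sums: lower bounds have larger tails, upper bounds smaller
  ones.\<close>

lemma le_LB_iff:
  "configuration a \<Longrightarrow> configuration b \<Longrightarrow> b \<sqsubseteq>\<^bsub>LB\<^esub> a \<longleftrightarrow> (\<forall>j\<ge>2. tail a j \<le> tail b j)"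
  by (simp add: LB_def reachable_iff_tail_le)

lemma eq_LB: "(.=\<^bsub>LB\<^esub>) = (=)"
  by (simp add: LB_def)

lemma partial_order_LB: "partial_order LB"
proof
  fix x y z :: config
  assume "x \<sqsubseteq>\<^bsub>LB\<^esub> y" "y \<sqsubseteq>\<^bsub>LB\<^esub> x" "x \<in> carrier LB" "y \<in> carrier LB"
  then have xy: "configuration x" "configuration y" "\<forall>j\<ge>2. tail y j \<le> tail x j"
    "\<forall>j\<ge>2. tail x j \<le> tail y j"
    by (simp_all add: carrier_LB le_LB_iff)
  have "x = y"
    by (rule configuration_eqI[OF xy(1,2)]) (simp add: xy order.antisym)
  then show "x .=\<^bsub>LB\<^esub> y"
    by (simp add: eq_LB)
next
  fix x y z :: config
  assume "x \<sqsubseteq>\<^bsub>LB\<^esub> y" "y \<sqsubseteq>\<^bsub>LB\<^esub> z"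
  then show "x \<sqsubseteq>\<^bsub>LB\<^esub> z"
    by (simp add: LB_def)
qed (simp_all add: LB_def)

lemma greatest_inf_config:
  assumes "configuration a" "configuration b"
  shows "greatest LB (inf_config a b) (Lower LB {a, b})"
  using assms configuration_inf_config[OF assms]
  by (auto simp: greatest_def Lower_def carrier_LB le_LB_iff tail_inf_config)

lemma ex_least_Upper:
  assumes "configuration a" "configuration b"
  shows "\<exists>s. least LB s (Upper LB {a, b})"
proof -
  obtain s where s: "configuration s" "\<And>j. 2 \<le> j \<Longrightarrow> tail s j \<le> min (tail a j) (tail b j)"
    and greatest: "\<And>v j. configuration v \<Longrightarrow> (\<And>j. 2 \<le> j \<Longrightarrow> tail v j \<le> min (tail a j) (tail b j))
      \<Longrightarrow> 2 \<le> j \<Longrightarrow> tail v j \<le> tail s j"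
    by (rule ex_greatest_tail_below[OF assms(1), of b]) blast
  have "least LB s (Upper LB {a, b})"
    unfolding least_def
  proof (intro conjI ballI)
    show "Upper LB {a, b} \<subseteq> carrier LB"
      by (rule Upper_closed)
    show "s \<in> Upper LB {a, b}"
      using s assms by (auto simp: Upper_def carrier_LB le_LB_iff)
    fix v assume "v \<in> Upper LB {a, b}"
    then show "s \<sqsubseteq>\<^bsub>LB\<^esub> v"
      using s assms greatest[of v] by (auto simp: Upper_def carrier_LB le_LB_iff)
  qed
  then show ?thesis by blast
qed

theorem theorem2:
  shows "lattice LB \<and>
    (\<forall>a\<in>carrier LB. \<forall>b\<in>carrier LB. a \<sqinter>\<^bsub>LB\<^esub> b = inf_config a b)"
proof -
  interpret partial_order LB
    by (rule partial_order_LB)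
  interpret lattice LB
  proof
    fix a b assume "a \<in> carrier LB" "b \<in> carrier LB"
    then have "configuration a" "configuration b"
      by (simp_all add: carrier_LB)
    then show "\<exists>s. least LB s (Upper LB {a, b})" "\<exists>s. greatest LB s (Lower LB {a, b})"
      using ex_least_Upper greatest_inf_config by blast+
  qed
  have "a \<sqinter>\<^bsub>LB\<^esub> b = inf_config a b" if "a \<in> carrier LB" "b \<in> carrier LB" for a b
    \<comment> \<open>The library meet is a chosen greatest lower bound, so uniqueness identifies it
      with \<open>inf_config a b\<close>.\<close>
    using greatest_unique[OF inf_of_two_greatest[OF that] greatest_inf_config] that
    by (simp add: meet_def carrier_LB)
  then show ?thesis
    using lattice_axioms by blast
qed

end
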